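(* Let $-\infty<a<b<\infty$, let $\gamma>0$ be a constant, and let $p_1,p_2$ be Lebesgue measurable real-valued functions on $[a,b]$ that are bounded away from one and infinity, i.e. there is $\varepsilon>0$ with $1+\varepsilon<p_i(x)<1/\varepsilon$ for almost every $x\in[a,b]$, $i=1,2$. Then $\Lambda_\gamma^{p_1}(m)=\Lambda_\gamma^{p_2}(m)$ for all $m>0$ if and only if $p_1$ and $p_2$ are equimeasurable with respect to the Lebesgue measure.
   Context: For a (positive, bounded, bounded away from zero) measurable weight $\gamma$ and a measurable exponent $p$ on $[a,b]$, bounded away from one and infinity, and for $m>0$, let $K_m=K_m(\gamma,p)>0$ be the unique positive number satisfying $$m=\int_a^b \gamma(x)^{-1/(p(x)-1)}K_m^{1/(p(x)-1)}\,dx .$$ (The map $m\mapsto K_m$ is a well-defined, strictly increasing continuous bijection of $(0,\infty)$ onto itself with continuous inverse.) The Dirichlet-to-Neumann (DN) map is the function $$\Lambda_\gamma^p(m)=\int_a^b\gamma(x)^{-1/(p(x)-1)}K_m^{p(x)/(p(x)-1)}\,dx=mK_m,\qquad m>0 .$$ It arises from the one-dimensional equation $-(\gamma(x)|u'(x)|^{p(x)-2}u'(x))'=0$ on $(a,b)$ with $u(a)=A$, $u(b)=B$, $m=B-A$. Two functions $p_1,p_2$ on $[a,b]$ are equimeasurable with respect to the Lebesgue measure $|\cdot|$ if $|\{x\in[a,b]: p_1(x)>t\}|=|\{x\in[a,b]: p_2(x)>t\}|$ for all $t\in[0,\infty]$. *)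

theory Defs
  imports "HOL-Analysis.Analysis"
begin

text \<open>
  Weights and exponents are functions \<open>real \<Rightarrow> real\<close> of which only the values on
  \<open>[a, b]\<close> are used. Every integral below is a Lebesgue integral over \<open>[a, b]\<close>.
  The Bochner integral of a non-integrable function is 0, so for \<open>m > 0\<close> the equation defining
  \<open>K_of\<close> can only hold with an integrable integrand.
\<close>

definition K_of :: "real \<Rightarrow> real \<Rightarrow> (real \<Rightarrow> real) \<Rightarrow> (real \<Rightarrow> real) \<Rightarrow> real \<Rightarrow> real" where
  "K_of a b \<gamma> p m = (THE K. K > 0 \<and>
     m = (LINT x|lebesgue_on {a..b}. \<gamma> x powr (- 1 / (p x - 1)) * K powr (1 / (p x - 1))))"

definition DN_map :: "real \<Rightarrow> real \<Rightarrow> (real \<Rightarrow> real) \<Rightarrow> (real \<Rightarrow> real) \<Rightarrow> real \<Rightarrow> real" where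
  "DN_map a b \<gamma> p m =
     (LINT x|lebesgue_on {a..b}.
        \<gamma> x powr (- 1 / (p x - 1)) * K_of a b \<gamma> p m powr (p x / (p x - 1)))"

definition equimeasurable_on :: "real \<Rightarrow> real \<Rightarrow> (real \<Rightarrow> real) \<Rightarrow> (real \<Rightarrow> real) \<Rightarrow> bool" where
  "equimeasurable_on a b p q \<longleftrightarrow>
     (\<forall>t::ereal. 0 \<le> t \<longrightarrow>
        emeasure lebesgue {x \<in> {a..b}. ereal (p x) > t} =
        emeasure lebesgue {x \<in> {a..b}. ereal (q x) > t})"

end

theory Submission
  imports Defs
begin

text \<open>
  Write \<open>q = 1 / (p - 1)\<close>, a bounded function which is bounded away from zero almost everywhere,
  and \<open>F\<^sub>p(s) = \<integral> s\<^bsup>q\<^esup>\<close> over \<open>[a, b]\<close>. For a constant weight the defining equation of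
  \<open>K\<^sub>m\<close> reads \<open>m = F\<^sub>p(K\<^sub>m / \<gamma>)\<close>, and \<open>F\<^sub>p\<close> is a strictly increasing bijection of \<open>(0, \<infinity>)\<close>.
  The DN map is \<open>m \<mapsto> m K\<^sub>m\<close>, so it determines the inverse of \<open>F\<^sub>p\<close> and hence \<open>F\<^sub>p\<close> itself.

  The values \<open>F\<^sub>p(exp (- n))\<close> are the moments of \<open>Y = exp (- q)\<close>, which takes values in
  \<open>[0, 1]\<close> almost everywhere. By the Weierstrass approximation theorem they determine the distribution of
  \<open>Y\<close> (lemma \<open>measure_eqI_moments\<close>), and since \<open>p = 1 - 1 / ln Y\<close> almost everywhere, they determine
  the distribution of \<open>p\<close>. Equimeasurability says exactly that the distributions of the two exponents
  agree (lemma \<open>equimeasurable_on_iff_distr_eq\<close>). Conversely, the DN map is built from integrals of Borel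
  functions of \<open>p\<close>, so it depends only on the distribution of \<open>p\<close>.
\<close>

section \<open>The Hausdorff moment problem: uniqueness\<close>

lemma integrable_continuous_unit_interval:
  fixes M :: "real measure" and f :: "real \<Rightarrow> real"
  assumes "finite_measure M" and "sets M = sets borel" and "AE x in M. x \<in> {0..1}" and f: "continuous_on UNIV f"
  shows "integrable M f"
proof -
  interpret finite_measure M by fact
  have "compact (f ` {0..1})"
    by (intro compact_continuous_image continuous_on_subset[OF f]) auto
  then obtain B where B: "\<And>x. x \<in> {0..1} \<Longrightarrow> norm (f x) \<le> B"
    using compact_imp_bounded bounded_iff by (metis imageI)
  have "f \<in> borel_measurable M"
    using borel_measurable_continuous_onI[OF f] assms(2) measurable_cong_sets by blast
  then show ?thesis
    using assms(3) B by (intro integrable_const_bound[of _ B]) (auto elim: eventually_mono)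
qed

text \<open>
  Equal moments give equal integrals of polynomials, and these are uniformly dense in the
  continuous functions on \<open>[0, 1]\<close>.
\<close>
lemma integral_continuous_eq_of_moments:
  fixes M N :: "real measure" and f :: "real \<Rightarrow> real"
  assumes M: "finite_measure M" "sets M = sets borel" "AE x in M. x \<in> {0..1}"
    and N: "finite_measure N" "sets N = sets borel" "AE x in N. x \<in> {0..1}"
    and moments: "\<And>n. (LINT x|M. x ^ n) = (LINT x|N. x ^ n)"
    and f: "continuous_on UNIV f"
  shows "(LINT x|M. f x) = (LINT x|N. f x)"
proof -
  define D where "D = measure M (space M) + measure N (space N) + 1"
  have D: "D > 0"
    unfolding D_def by (smt (verit) measure_nonneg)
  have close: "\<bar>(LINT x|L. f x) - (LINT x|L. g x)\<bar> \<le> e * measure L (space L)"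
    if L: "finite_measure L" "sets L = sets borel" "AE x in L. x \<in> {0..1}"
      and g: "continuous_on UNIV g" and fg: "\<And>x. x \<in> {0..1} \<Longrightarrow> \<bar>f x - g x\<bar> < e"
    for L :: "real measure" and g e
  proof -
    interpret finite_measure L by fact
    note int = integrable_continuous_unit_interval[OF L]
    have "\<bar>(LINT x|L. f x) - (LINT x|L. g x)\<bar> = \<bar>LINT x|L. f x - g x\<bar>"
      by (simp add: int f g)
    also have "\<dots> \<le> (LINT x|L. \<bar>f x - g x\<bar>)"
      using integral_norm_bound[of L "\<lambda>x. f x - g x"] by simp
    also have "\<dots> \<le> (LINT x|L. e)"
    proof (rule integral_mono_AE)
      show "AE x in L. \<bar>f x - g x\<bar> \<le> e"
        using L(3) by eventually_elim (use fg less_imp_le in blast)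
    qed (auto intro!: int continuous_intros f g)
    finally show ?thesis by (simp add: mult.commute)
  qed
  have "\<bar>(LINT x|M. f x) - (LINT x|N. f x)\<bar> \<le> d" if d: "d > 0" for d
  proof -
    obtain g where g: "real_polynomial_function g" "\<And>x. x \<in> {0..1} \<Longrightarrow> \<bar>f x - g x\<bar> < d / D"
      using Stone_Weierstrass_real_polynomial_function[of "{0..1}" f "d / D"] d D
        continuous_on_subset[OF f] by auto
    obtain c n where gc: "g = (\<lambda>x. \<Sum>i\<le>n. c i * x ^ i)"
      using g(1) real_polynomial_function_iff_sum by auto
    have cont: "continuous_on UNIV g"
      unfolding gc by (intro continuous_intros)
    have int: "(LINT x|L. g x) = (\<Sum>i\<le>n. c i * (LINT x|L. x ^ i))"
      if L: "finite_measure L" "sets L = sets borel" "AE x in L. x \<in> {0..1}" for L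
    proof -
      have "integrable L (\<lambda>x. x ^ i)" for i
        by (intro integrable_continuous_unit_interval[OF L] continuous_intros)
      then show ?thesis
        unfolding gc by (subst Bochner_Integration.integral_sum) auto
    qed
    have "(LINT x|M. g x) = (LINT x|N. g x)"
      by (simp add: int[OF M] int[OF N] moments)
    then have "\<bar>(LINT x|M. f x) - (LINT x|N. f x)\<bar>
        \<le> d / D * measure M (space M) + d / D * measure N (space N)"
      using close[OF M cont g(2)] close[OF N cont g(2)] by linarith
    also have "\<dots> = d / D * (D - 1)"
      unfolding distrib_left[symmetric] by (simp add: D_def)
    also have "\<dots> \<le> d"
      using d D by (simp add: field_simps)
    finally show ?thesis .
  qed
  then have "\<bar>(LINT x|M. f x) - (LINT x|N. f x)\<bar> \<le> 0"
    by (rule dense_ge)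
  then show ?thesis by simp
qed

lemma measure_eqI_moments:
  fixes M N :: "real measure"
  assumes M: "finite_measure M" "sets M = sets borel" "AE x in M. x \<in> {0..1}"
    and N: "finite_measure N" "sets N = sets borel" "AE x in N. x \<in> {0..1}"
    and moments: "\<And>n. (LINT x|M. x ^ n) = (LINT x|N. x ^ n)"
  shows "M = N"
proof (rule measure_eqI_lessThan)
  interpret M: finite_measure M by fact
  interpret N: finite_measure N by fact
  fix t :: real
  show "emeasure M {t<..} < \<infinity>"
    using M.emeasure_finite[of "{t<..}"] by (simp flip: less_top)
  \<comment> \<open>Continuous ramps increasing pointwise to the indicator of \<open>(t, \<infinity>)\<close>.\<close>
  define f where "f k x = min 1 (max 0 (real k * (x - t)))" for k x
  have cont: "continuous_on UNIV (f k)" for k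
    unfolding f_def by (intro continuous_intros)
  have lim_f: "(\<lambda>k. f k x) \<longlonglongrightarrow> indicator {t<..} x" for x
  proof (cases "x > t")
    case True
    obtain k0 where "1 / (x - t) < real k0"
      using reals_Archimedean2 by blast
    then have "f k x = 1" if "k \<ge> k0" for k
    proof -
      have "1 / (x - t) \<le> real k" using \<open>1 / (x - t) < real k0\<close> that by linarith
      then have "1 \<le> real k * (x - t)" using True by (simp add: field_simps)
      then show ?thesis by (simp add: f_def)
    qed
    then show ?thesis
      using True by (intro tendsto_eventually) (auto simp: eventually_sequentially)
  next
    case False
    then have "real k * (x - t) \<le> 0" for k
      by (intro mult_nonneg_nonpos) auto
    then have "f k x = 0" for k
      by (simp add: f_def max_absorb1)
    then show ?thesis using False by simp
  qed
  have lim: "(\<lambda>k. LINT x|L. f k x) \<longlonglongrightarrow> measure L {t<..}"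
    if L: "finite_measure L" "sets L = sets borel" for L
  proof -
    interpret finite_measure L by fact
    have [measurable_cong]: "sets L = sets borel" by fact
    have sp: "space L = UNIV" using sets_eq_imp_space_eq[OF L(2)] by simp
    have [measurable]: "f k \<in> borel_measurable L" for k
      using borel_measurable_continuous_onI[OF cont] L(2) measurable_cong_sets by blast
    have "(\<lambda>k. LINT x|L. f k x) \<longlonglongrightarrow> (LINT x|L. indicator {t<..} x)"
      using lim_f by (intro integral_dominated_convergence[where w="\<lambda>_. 1"]) (auto simp: f_def)
    then show ?thesis by (simp add: sp)
  qed
  have "(LINT x|M. f k x) = (LINT x|N. f k x)" for k
    by (rule integral_continuous_eq_of_moments[OF M N moments cont])
  then have "measure M {t<..} = measure N {t<..}"
    using lim[OF M(1,2)] lim[OF N(1,2)] by (auto intro: LIMSEQ_unique)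
  then show "emeasure M {t<..} = emeasure N {t<..}"
    by (simp add: M.emeasure_eq_measure N.emeasure_eq_measure)
qed (use M N in auto)

section \<open>Integrals of powers with a variable exponent\<close>

lemma (in finite_measure)
  fixes q :: "'a \<Rightarrow> real"
  assumes q [measurable]: "q \<in> borel_measurable M"
    and C: "AE x in M. 0 < q x \<and> q x \<le> C"
  shows integrable_powr_exponent: "0 < s \<Longrightarrow> integrable M (\<lambda>x. s powr q x)"
    and continuous_on_integral_powr_exponent: "continuous_on {0<..} (\<lambda>s. LINT x|M. s powr q x)"
proof -
  have bound: "AE x in M. norm (s powr q x) \<le> max 1 S powr C" if "0 < s" "s \<le> S" for s S
    using C
  proof eventually_elim
    case (elim x)
    have "s powr q x \<le> max 1 S powr q x"
      using that elim by (intro powr_mono2) auto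
    also have "\<dots> \<le> max 1 S powr C"
      using elim by (intro powr_mono) auto
    finally show ?case by simp
  qed
  show "integrable M (\<lambda>x. s powr q x)" if "0 < s"
    using bound[OF that order_refl] by (rule integrable_const_bound) measurable
  show "continuous_on {0<..} (\<lambda>s. LINT x|M. s powr q x)"
    unfolding continuous_on_sequentially comp_def
  proof safe
    fix X :: "nat \<Rightarrow> real" and s :: real
    assume s: "0 < s" and pos: "\<forall>n. X n \<in> {0<..}" and X: "X \<longlonglongrightarrow> s"
    obtain S where S: "\<And>n. X n \<le> S"
      using convergent_imp_Bseq[OF convergentI[OF X]] by (auto simp: Bseq_def abs_le_iff)
    show "(\<lambda>n. LINT x|M. X n powr q x) \<longlonglongrightarrow> (LINT x|M. s powr q x)"
    proof (rule integral_dominated_convergence[where w="\<lambda>_. max 1 S powr C"])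
      show "AE x in M. (\<lambda>n. X n powr q x) \<longlonglongrightarrow> s powr q x"
        using s by (intro AE_I2 tendsto_intros X) auto
      show "AE x in M. norm (X n powr q x) \<le> max 1 S powr C" for n
        using bound pos S by simp
    qed simp_all
  qed
qed

lemma (in finite_measure) integral_powr_exponent_strict_mono:
  fixes q :: "'a \<Rightarrow> real"
  assumes q: "q \<in> borel_measurable M" and C: "AE x in M. 0 < q x \<and> q x \<le> C"
    and "emeasure M (space M) \<noteq> 0" and "0 < s" "s < t"
  shows "(LINT x|M. s powr q x) < (LINT x|M. t powr q x)"
  using assms C
  by (intro integral_less_AE_space integrable_powr_exponent[OF q C])
     (auto elim!: eventually_mono intro!: powr_less_mono2)

lemma (in finite_measure) ex_integral_powr_exponent_eq:
  fixes q :: "'a \<Rightarrow> real"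
  assumes q: "q \<in> borel_measurable M"
    and "0 < c" and cC: "AE x in M. c \<le> q x \<and> q x \<le> C"
    and "emeasure M (space M) \<noteq> 0" and "0 < m"
  shows "\<exists>s>0. (LINT x|M. s powr q x) = m"
proof -
  define F where "F s = (LINT x|M. s powr q x)" for s
  define L where "L = measure M (space M)"
  have L: "L > 0"
    using assms(4) by (simp add: L_def emeasure_eq_measure zero_less_measure_iff)
  have C: "AE x in M. 0 < q x \<and> q x \<le> C"
    using cC \<open>0 < c\<close> by (auto elim!: eventually_mono)
  note int = integrable_powr_exponent[OF q C]
  have cont: "continuous_on {u..v} F" if "0 < u" for u v
    unfolding F_def
    by (rule continuous_on_subset[OF continuous_on_integral_powr_exponent[OF q C]]) (use that in auto)
  have F1: "F 1 = L"
    by (simp add: F_def L_def)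
  \<comment> \<open>Replacing \<open>q\<close> by its lower bound \<open>c\<close> gives an explicit point \<open>s\<close> with \<open>s\<^bsup>c\<^esup> L = m\<close>,
    and \<open>m\<close> lies between \<open>F 1\<close> and \<open>F s\<close>.\<close>
  define s where "s = (m / L) powr (1 / c)"
  have s: "0 < s" "L * s powr c = m"
    using L \<open>0 < m\<close> \<open>0 < c\<close> by (auto simp: s_def powr_powr)
  have const: "(LINT x|M. s powr c) = m"
    using s by (simp add: L_def)
  show ?thesis
  proof (cases "m \<ge> L")
    case True
    then have "1 \<le> s"
      using L \<open>0 < c\<close> by (auto simp: s_def intro!: ge_one_powr_ge_zero)
    have "(LINT x|M. s powr c) \<le> F s"
      unfolding F_def using cC \<open>1 \<le> s\<close> s(1)
      by (intro integral_mono_AE int) (auto elim!: eventually_mono intro!: powr_mono)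
    then have "\<exists>u\<ge>1. u \<le> s \<and> F u = m"
      using IVT'[of F 1 m s] F1 True \<open>1 \<le> s\<close> cont[of 1 s] const by auto
    then show ?thesis
      unfolding F_def by (metis less_le_trans zero_less_one)
  next
    case False
    then have "s \<le> 1"
      using L \<open>0 < m\<close> \<open>0 < c\<close> by (auto simp: s_def intro!: powr_le1)
    have "F s \<le> (LINT x|M. s powr c)"
      unfolding F_def using cC \<open>s \<le> 1\<close> s(1)
      by (intro integral_mono_AE int) (auto elim!: eventually_mono intro!: powr_mono')
    then have "\<exists>u\<ge>s. u \<le> 1 \<and> F u = m"
      using IVT'[of F s m 1] F1 False \<open>s \<le> 1\<close> cont[of s 1] s(1) const by auto
    then show ?thesis
      unfolding F_def using s(1) by (metis less_le_trans)
  qed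
qed

section \<open>Equimeasurability as equality of distributions\<close>

lemma finite_measure_distr_Icc:
  assumes "f \<in> borel_measurable (lebesgue_on {a..b::real})"
  shows "finite_measure (distr (lebesgue_on {a..b}) borel f)"
  using assms by (intro finite_measure.finite_measure_distr finite_measure_lebesgue_on) auto

lemma emeasure_distr_greaterThan:
  fixes p :: "real \<Rightarrow> real"
  assumes "p \<in> borel_measurable (lebesgue_on {a..b})"
  shows "emeasure (distr (lebesgue_on {a..b}) borel p) {t<..}
    = emeasure lebesgue {x \<in> {a..b}. ereal (p x) > ereal t}"
  using assms
  by (subst emeasure_distr)
     (auto simp: emeasure_restrict_space space_restrict_space intro!: arg_cong[where f="emeasure lebesgue"])

text \<open>
  Positivity of the exponents makes up for the levels \<open>t < 0\<close>, which equimeasurability does not test.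
\<close>
lemma equimeasurable_on_iff_distr_eq:
  fixes p q :: "real \<Rightarrow> real"
  assumes p: "p \<in> borel_measurable (lebesgue_on {a..b})" "AE x in lebesgue_on {a..b}. p x > 0"
    and q: "q \<in> borel_measurable (lebesgue_on {a..b})" "AE x in lebesgue_on {a..b}. q x > 0"
  shows "equimeasurable_on a b p q \<longleftrightarrow>
    distr (lebesgue_on {a..b}) borel p = distr (lebesgue_on {a..b}) borel q"
    (is "_ \<longleftrightarrow> ?P = ?Q")
proof
  assume eq: "equimeasurable_on a b p q"
  show "?P = ?Q"
  proof (rule measure_eqI_lessThan)
    interpret P: finite_measure ?P by (rule finite_measure_distr_Icc[OF p(1)])
    fix t :: real
    show "emeasure ?P {t<..} < \<infinity>"
      using P.emeasure_finite[of "{t<..}"] by (simp flip: less_top)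
    have nonneg: "emeasure ?P {s<..} = emeasure ?Q {s<..}" if "0 \<le> s" for s
      using eq[unfolded equimeasurable_on_def, rule_format, of "ereal s"] that
      by (simp only: emeasure_distr_greaterThan[OF p(1)] emeasure_distr_greaterThan[OF q(1)]
          ereal_less_eq)
    have neg: "emeasure (distr (lebesgue_on {a..b}) borel r) {t<..}
        = emeasure (distr (lebesgue_on {a..b}) borel r) {0<..}"
      if r: "r \<in> borel_measurable (lebesgue_on {a..b})" "AE x in lebesgue_on {a..b}. r x > 0"
        and "t < 0" for r
    proof (rule emeasure_eq_AE)
      have "AE x in distr (lebesgue_on {a..b}) borel r. x > 0"
        using r by (subst AE_distr_iff) auto
      then show "AE x in distr (lebesgue_on {a..b}) borel r. x \<in> {t<..} \<longleftrightarrow> x \<in> {0<..}"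
        using \<open>t < 0\<close> by (auto elim!: eventually_mono)
    qed auto
    show "emeasure ?P {t<..} = emeasure ?Q {t<..}"
    proof (cases "t < 0")
      case True
      then show ?thesis using nonneg[of 0] neg p q by simp
    next
      case False
      then show ?thesis using nonneg by simp
    qed
  qed auto
next
  assume eq: "?P = ?Q"
  show "equimeasurable_on a b p q"
    unfolding equimeasurable_on_def
  proof (intro allI impI)
    fix t :: ereal assume "0 \<le> t"
    then consider r where "t = ereal r" | "t = \<infinity>"
      by (cases t) auto
    then show "emeasure lebesgue {x \<in> {a..b}. ereal (p x) > t}
        = emeasure lebesgue {x \<in> {a..b}. ereal (q x) > t}"
      using emeasure_distr_greaterThan[OF p(1)] emeasure_distr_greaterThan[OF q(1)] eq
      by cases auto
  qed
qed

section \<open>The Dirichlet-to-Neumann map\<close>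

text \<open>The integral \<open>F\<^sub>p\<close> whose inverse, up to the factor \<open>\<gamma>\<close>, is \<open>m \<mapsto> K\<^sub>m\<close>.\<close>
definition flux_integral :: "real \<Rightarrow> real \<Rightarrow> (real \<Rightarrow> real) \<Rightarrow> real \<Rightarrow> real" where
  "flux_integral a b p s = (LINT x|lebesgue_on {a..b}. s powr (1 / (p x - 1)))"

text \<open>
  A measurable exponent on \<open>[a, b]\<close> bounded away from one and infinity; a single \<open>\<epsilon>\<close> serves for both
  bounds. The bounds hold almost everywhere only, so \<open>1 / (p x - 1)\<close> may be arbitrary on a null set.
\<close>
locale admissible_exponent =
  fixes a b :: real and p :: "real \<Rightarrow> real"
  assumes a_less_b: "a < b"
    and p_measurable: "p \<in> borel_measurable (lebesgue_on {a..b})"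
    and p_bounds: "\<exists>\<epsilon>>0. AE x in lebesgue_on {a..b}. 1 + \<epsilon> < p x \<and> p x < 1 / \<epsilon>"
begin

sublocale finite_measure "lebesgue_on {a..b}"
  by (rule finite_measure_lebesgue_on) auto

lemma AE_p_gt_1: "AE x in lebesgue_on {a..b}. p x > 1"
  using p_bounds by (auto elim!: eventually_mono)

lemma emeasure_Icc_nonzero: "emeasure (lebesgue_on {a..b}) (space (lebesgue_on {a..b})) \<noteq> 0"
  using a_less_b by (simp add: emeasure_restrict_space space_restrict_space)

lemma measurable_q: "(\<lambda>x. 1 / (p x - 1)) \<in> borel_measurable (lebesgue_on {a..b})"
  using p_measurable by measurable

lemma q_bounds:
  obtains c C where "0 < c" "AE x in lebesgue_on {a..b}. c \<le> 1 / (p x - 1) \<and> 1 / (p x - 1) \<le> C"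
proof -
  obtain \<epsilon> where \<epsilon>: "\<epsilon> > 0" "AE x in lebesgue_on {a..b}. 1 + \<epsilon> < p x \<and> p x < 1 / \<epsilon>"
    using p_bounds by auto
  have "AE x in lebesgue_on {a..b}. \<epsilon> \<le> 1 / (p x - 1) \<and> 1 / (p x - 1) \<le> 1 / \<epsilon>"
    using \<epsilon>(2)
  proof eventually_elim
    case (elim x)
    have "\<epsilon> * p x < 1" using elim \<epsilon>(1) by (simp add: field_simps)
    then have "\<epsilon> * (p x - 1) \<le> 1" using \<epsilon>(1) by (simp add: algebra_simps)
    then show ?case using elim \<epsilon>(1) by (auto simp: field_simps)
  qed
  then show thesis using that \<epsilon>(1) by blast
qed

lemma flux_integral_strict_mono:
  assumes "0 < s" "s < t"
  shows "flux_integral a b p s < flux_integral a b p t"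
proof -
  obtain c C where c: "0 < c" "AE x in lebesgue_on {a..b}. c \<le> 1 / (p x - 1) \<and> 1 / (p x - 1) \<le> C"
    using q_bounds .
  have "AE x in lebesgue_on {a..b}. 0 < 1 / (p x - 1) \<and> 1 / (p x - 1) \<le> C"
    using c(2) by eventually_elim (use c(1) in linarith)
  from integral_powr_exponent_strict_mono[OF measurable_q this emeasure_Icc_nonzero assms]
  show ?thesis by (simp add: flux_integral_def)
qed

lemma flux_integral_inj:
  assumes "0 < s" "0 < t" "flux_integral a b p s = flux_integral a b p t"
  shows "s = t"
  using flux_integral_strict_mono[of s t] flux_integral_strict_mono[of t s] assms by force

lemma flux_integral_pos:
  assumes "0 < s"
  shows "0 < flux_integral a b p s"
proof -
  have "0 \<le> flux_integral a b p (s / 2)"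
    unfolding flux_integral_def by (intro integral_nonneg_AE) auto
  then show ?thesis using flux_integral_strict_mono[of "s / 2" s] assms by simp
qed

lemma flux_integral_surj:
  assumes "0 < m"
  shows "\<exists>s>0. flux_integral a b p s = m"
proof -
  obtain c C where "0 < c" "AE x in lebesgue_on {a..b}. c \<le> 1 / (p x - 1) \<and> 1 / (p x - 1) \<le> C"
    using q_bounds .
  from ex_integral_powr_exponent_eq[OF measurable_q this emeasure_Icc_nonzero assms]
  show ?thesis by (simp add: flux_integral_def)
qed

lemma weighted_integral_eq_flux_integral:
  assumes "0 < \<gamma>" "0 < K"
  shows "(LINT x|lebesgue_on {a..b}. \<gamma> powr (- 1 / (p x - 1)) * K powr (1 / (p x - 1)))
    = flux_integral a b p (K / \<gamma>)"
proof -
  have "\<gamma> powr (- 1 / (p x - 1)) * K powr (1 / (p x - 1)) = (K / \<gamma>) powr (1 / (p x - 1))" for x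
    using assms by (simp add: powr_divide powr_minus_divide flip: minus_divide_left)
  then show ?thesis by (simp add: flux_integral_def)
qed

lemma K_of_flux_integral:
  assumes "0 < \<gamma>" "0 < K"
  shows "K_of a b (\<lambda>x. \<gamma>) p (flux_integral a b p (K / \<gamma>)) = K"
  unfolding K_of_def
proof (rule the_equality)
  fix K' assume "0 < K' \<and> flux_integral a b p (K / \<gamma>)
    = (LINT x|lebesgue_on {a..b}. \<gamma> powr (- 1 / (p x - 1)) * K' powr (1 / (p x - 1)))"
  then have "0 < K'" "flux_integral a b p (K / \<gamma>) = flux_integral a b p (K' / \<gamma>)"
    using weighted_integral_eq_flux_integral[OF assms(1), of K'] by auto
  then show "K' = K"
    using flux_integral_inj[of "K / \<gamma>" "K' / \<gamma>"] assms by simp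
qed (use assms weighted_integral_eq_flux_integral[OF assms] in metis)

lemma DN_map_flux_integral:
  assumes "0 < \<gamma>" "0 < K"
  shows "DN_map a b (\<lambda>x. \<gamma>) p (flux_integral a b p (K / \<gamma>)) = flux_integral a b p (K / \<gamma>) * K"
proof -
  have "DN_map a b (\<lambda>x. \<gamma>) p (flux_integral a b p (K / \<gamma>))
      = (LINT x|lebesgue_on {a..b}. \<gamma> powr (- 1 / (p x - 1)) * K powr (p x / (p x - 1)))"
    by (simp add: DN_map_def K_of_flux_integral[OF assms])
  also have "\<dots> = (LINT x|lebesgue_on {a..b}.
      (\<gamma> powr (- 1 / (p x - 1)) * K powr (1 / (p x - 1))) * K)"
  proof (rule integral_cong_AE)
    show "AE x in lebesgue_on {a..b}. \<gamma> powr (- 1 / (p x - 1)) * K powr (p x / (p x - 1))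
        = (\<gamma> powr (- 1 / (p x - 1)) * K powr (1 / (p x - 1))) * K"
      using AE_p_gt_1
    proof eventually_elim
      case (elim x)
      have "p x / (p x - 1) = 1 / (p x - 1) + 1" using elim by (simp add: field_simps)
      then show ?case using assms by (simp add: powr_add)
    qed
  qed (use p_measurable in measurable)
  also have "\<dots> = flux_integral a b p (K / \<gamma>) * K"
    by (simp only: integral_mult_left_zero weighted_integral_eq_flux_integral[OF assms])
  finally show ?thesis .
qed

text \<open>
  The inverse on \<open>(0, 1)\<close> of \<open>p \<mapsto> exp (- 1 / (p - 1))\<close> is \<open>y \<mapsto> 1 - 1 / ln y\<close>, so the distribution of the
  transformed exponent determines that of the exponent.
\<close>
lemma distr_exponent_eq:
  "distr (lebesgue_on {a..b}) borel p =
    distr (distr (lebesgue_on {a..b}) borel (\<lambda>x. exp (- (1 / (p x - 1))))) borel (\<lambda>y. 1 - 1 / ln y)"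
proof -
  have [measurable]: "(\<lambda>x. exp (- (1 / (p x - 1)))) \<in> borel_measurable (lebesgue_on {a..b})"
    using measurable_q by measurable
  have "distr (lebesgue_on {a..b}) borel p
      = distr (lebesgue_on {a..b}) borel (\<lambda>x. 1 - 1 / ln (exp (- (1 / (p x - 1)))))"
    by (rule distr_cong_AE) (use AE_p_gt_1 p_measurable in auto)
  also have "\<dots> = distr (distr (lebesgue_on {a..b}) borel (\<lambda>x. exp (- (1 / (p x - 1))))) borel
      (\<lambda>y. 1 - 1 / ln y)"
    by (subst distr_distr) (auto simp: comp_def)
  finally show ?thesis .
qed

lemma AE_distr_exp_unit_interval:
  "AE y in distr (lebesgue_on {a..b}) borel (\<lambda>x. exp (- (1 / (p x - 1)))). y \<in> {0..1}"
proof -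
  have "(\<lambda>x. exp (- (1 / (p x - 1)))) \<in> borel_measurable (lebesgue_on {a..b})"
    using measurable_q by measurable
  then show ?thesis
    using AE_p_gt_1 by (subst AE_distr_iff) (auto elim!: eventually_mono)
qed

lemma moment_eq_flux_integral:
  "(LINT y|distr (lebesgue_on {a..b}) borel (\<lambda>x. exp (- (1 / (p x - 1)))). y ^ n)
    = flux_integral a b p (exp (- real n))"
proof -
  have "(\<lambda>x. exp (- (1 / (p x - 1)))) \<in> borel_measurable (lebesgue_on {a..b})"
    using measurable_q by measurable
  then have "(LINT y|distr (lebesgue_on {a..b}) borel (\<lambda>x. exp (- (1 / (p x - 1)))). y ^ n)
      = (LINT x|lebesgue_on {a..b}. exp (- (1 / (p x - 1))) ^ n)"
    by (rule integral_distr) simp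
  also have "\<dots> = flux_integral a b p (exp (- real n))"
    unfolding flux_integral_def
    by (intro Bochner_Integration.integral_cong) (auto simp: powr_def simp flip: exp_of_nat_mult)
  finally show ?thesis .
qed

end

lemma distr_eq_of_flux_integral_eq:
  assumes "admissible_exponent a b p" "admissible_exponent a b q"
    and eq: "\<And>s. 0 < s \<Longrightarrow> flux_integral a b p s = flux_integral a b q s"
  shows "distr (lebesgue_on {a..b}) borel p = distr (lebesgue_on {a..b}) borel q"
proof -
  interpret p: admissible_exponent a b p by fact
  interpret q: admissible_exponent a b q by fact
  have "distr (lebesgue_on {a..b}) borel (\<lambda>x. exp (- (1 / (p x - 1))))
      = distr (lebesgue_on {a..b}) borel (\<lambda>x. exp (- (1 / (q x - 1))))"
    using p.measurable_q q.measurable_q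
    by (intro measure_eqI_moments finite_measure_distr_Icc p.AE_distr_exp_unit_interval
        q.AE_distr_exp_unit_interval) (auto simp: p.moment_eq_flux_integral q.moment_eq_flux_integral eq)
  then show ?thesis
    by (simp add: p.distr_exponent_eq q.distr_exponent_eq)
qed

lemma flux_integral_eq_of_DN_map_eq:
  assumes "admissible_exponent a b p" "admissible_exponent a b q" and \<gamma>: "0 < \<gamma>"
    and eq: "\<And>m. 0 < m \<Longrightarrow> DN_map a b (\<lambda>x. \<gamma>) p m = DN_map a b (\<lambda>x. \<gamma>) q m"
    and s: "0 < s"
  shows "flux_integral a b p s = flux_integral a b q s"
proof -
  interpret p: admissible_exponent a b p by fact
  interpret q: admissible_exponent a b q by fact
  define m where "m = flux_integral a b p s"
  have m: "0 < m" unfolding m_def by (rule p.flux_integral_pos[OF s])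
  then obtain t where t: "0 < t" "flux_integral a b q t = m"
    using q.flux_integral_surj by blast
  have "DN_map a b (\<lambda>x. \<gamma>) p m = m * (s * \<gamma>)"
    using p.DN_map_flux_integral[OF \<gamma>, of "s * \<gamma>"] s \<gamma> by (simp add: m_def)
  moreover have "DN_map a b (\<lambda>x. \<gamma>) q m = m * (t * \<gamma>)"
    using q.DN_map_flux_integral[OF \<gamma>, of "t * \<gamma>"] t \<gamma> by simp
  ultimately have "s = t"
    using eq[OF m] m \<gamma> by simp
  then show ?thesis using t by (simp add: m_def)
qed

lemma DN_map_eq_of_distr_eq:
  assumes p: "p \<in> borel_measurable (lebesgue_on {a..b})"
    and q: "q \<in> borel_measurable (lebesgue_on {a..b})"
    and eq: "distr (lebesgue_on {a..b}) borel p = distr (lebesgue_on {a..b}) borel q"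
  shows "DN_map a b (\<lambda>x. \<gamma>) p m = DN_map a b (\<lambda>x. \<gamma>) q m"
proof -
  have transfer: "(LINT x|lebesgue_on {a..b}. h (p x)) = (LINT x|lebesgue_on {a..b}. h (q x))"
    if h: "h \<in> borel_measurable borel" for h :: "real \<Rightarrow> real"
    using integral_distr[OF p h] integral_distr[OF q h] eq by simp
  have "(LINT x|lebesgue_on {a..b}. \<gamma> powr (- 1 / (p x - 1)) * K powr (1 / (p x - 1)))
      = (LINT x|lebesgue_on {a..b}. \<gamma> powr (- 1 / (q x - 1)) * K powr (1 / (q x - 1)))" for K
    by (rule transfer[of "\<lambda>y. \<gamma> powr (- 1 / (y - 1)) * K powr (1 / (y - 1))"]) measurable
  then have "K_of a b (\<lambda>x. \<gamma>) p m = K_of a b (\<lambda>x. \<gamma>) q m"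
    by (simp add: K_of_def)
  moreover have "(LINT x|lebesgue_on {a..b}. \<gamma> powr (- 1 / (p x - 1)) * K powr (p x / (p x - 1)))
      = (LINT x|lebesgue_on {a..b}. \<gamma> powr (- 1 / (q x - 1)) * K powr (q x / (q x - 1)))" for K
    by (rule transfer[of "\<lambda>y. \<gamma> powr (- 1 / (y - 1)) * K powr (y / (y - 1))"]) measurable
  ultimately show ?thesis
    by (simp add: DN_map_def)
qed

theorem corollary1:
  fixes a b \<gamma> :: real and p1 p2 :: "real \<Rightarrow> real"
  assumes "a < b"
    and "\<gamma> > 0"
    and "p1 \<in> borel_measurable (lebesgue_on {a..b})"
    and "p2 \<in> borel_measurable (lebesgue_on {a..b})"
    and "\<exists>\<epsilon>>0. AE x in lebesgue_on {a..b}. 1 + \<epsilon> < p1 x \<and> p1 x < 1 / \<epsilon>"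
    and "\<exists>\<epsilon>>0. AE x in lebesgue_on {a..b}. 1 + \<epsilon> < p2 x \<and> p2 x < 1 / \<epsilon>"
  shows "(\<forall>m>0. DN_map a b (\<lambda>x. \<gamma>) p1 m = DN_map a b (\<lambda>x. \<gamma>) p2 m)
     \<longleftrightarrow> equimeasurable_on a b p1 p2"
proof -
  interpret p1: admissible_exponent a b p1
    by unfold_locales (fact assms)+
  interpret p2: admissible_exponent a b p2
    by unfold_locales (fact assms)+
  note adm = p1.admissible_exponent_axioms p2.admissible_exponent_axioms
  have "AE x in lebesgue_on {a..b}. p1 x > 0" "AE x in lebesgue_on {a..b}. p2 x > 0"
    using p1.AE_p_gt_1 p2.AE_p_gt_1 by (force elim: eventually_mono)+
  from equimeasurable_on_iff_distr_eq[OF assms(3) this(1) assms(4) this(2)]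
  have "equimeasurable_on a b p1 p2 \<longleftrightarrow>
      distr (lebesgue_on {a..b}) borel p1 = distr (lebesgue_on {a..b}) borel p2" .
  moreover have "distr (lebesgue_on {a..b}) borel p1 = distr (lebesgue_on {a..b}) borel p2"
    if "\<forall>m>0. DN_map a b (\<lambda>x. \<gamma>) p1 m = DN_map a b (\<lambda>x. \<gamma>) p2 m"
    using that \<open>\<gamma> > 0\<close>
    by (intro distr_eq_of_flux_integral_eq[OF adm] flux_integral_eq_of_DN_map_eq[OF adm]) auto
  ultimately show ?thesis
    using DN_map_eq_of_distr_eq[OF assms(3,4)] by blast
qed

end
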